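(* Let $\mathcal{G}$ be an undirected, unweighted path graph of order $n$ (the cycle graph of order $n$ with one link removed), with nodes labelled $1,\dots,n$ consecutively along the path. Consider sets $S_2=\{s_1,s_2\}$ of two noise-free leaders. The optimal leader set is $S^*=\{s_1^*,s_2^*\}$ with $$s_1^*=\mathrm{rnd}\Big(\frac n5+\frac12\Big),\qquad s_2^*=\mathrm{rnd}\Big(\frac{4n}5+\frac12\Big),$$ i.e. $\{s_1^*,s_2^*\}$ minimizes the total system error over all sets of two noise-free leaders.
   Context: Setting. $\mathcal{G}$ is the path on $n\ge3$ nodes with all edge weights equal to $1$, $A$ its adjacency matrix, $D$ the diagonal degree matrix, and $L=D-A$ the Laplacian. $\mathrm{rnd}(x)$ denotes rounding of $x$ to the closest integer, with ties (half-integers) rounded up. Dynamics and error. For a set $S$ of nodes (leaders; here $S=\{s_1,s_2\}$ with $s_1\ne s_2$) and $k>0$, let $K$ be the diagonal matrix with $K_{i,i}=k$ for $i\in S$ and $K_{i,i}=0$ otherwise; $M=L+K$. For $\sigma>0$ the dynamics are $d\mathbf{x}=-M\mathbf{x}\,dt+\sigma\,d\mathbf{W}$, with $\mathbf{W}$ a vector of $n$ independent standard Wiener processes. $\Sigma$ is the steady-state covariance matrix of $\mathbf{x}$, i.e. the solution of $M\Sigma+\Sigma M^T=\sigma^2 I$. The total system error is $\mathrm{tr}(\Sigma)=\sum_{i=1}^n\Sigma_{i,i}=\frac{\sigma^2}{2}\sum_{i=1}^n (M^{-1})_{i,i}$. For noise-free leaders the total system error means the limit of this quantity as $k\to\infty$.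 For given $m$ (here $m=2$), an optimal leader set is a set of $m$ nodes minimizing the total system error over all sets of $m$ nodes. *)

theory Defs
  imports Complex_Main "Jordan_Normal_Form.Matrix"
begin

text \<open>Weighted graphs on the nodes \<open>1, \<dots>, n\<close> are given by their adjacency matrix. Matrix
  indices start at 0, so node \<open>i\<close> corresponds to row and column \<open>i - 1\<close>.\<close>

definition path_adjacency :: "nat \<Rightarrow> real mat" where
  "path_adjacency n = mat n n (\<lambda>(i, j). if j = Suc i \<or> i = Suc j then 1 else 0)"

definition degree_matrix :: "real mat \<Rightarrow> real mat" where
  "degree_matrix A = mat_diag (dim_row A) (\<lambda>i. \<Sum>j<dim_col A. A $$ (i, j))"

definition laplacian :: "real mat \<Rightarrow> real mat" where
  "laplacian A = degree_matrix A - A"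

definition leader_gain :: "nat \<Rightarrow> nat set \<Rightarrow> real \<Rightarrow> real mat" where
  "leader_gain n S k = mat_diag n (\<lambda>i. if Suc i \<in> S then k else 0)"

definition system_matrix :: "real mat \<Rightarrow> nat set \<Rightarrow> real \<Rightarrow> real mat" where
  "system_matrix A S k = laplacian A + leader_gain (dim_row A) S k"

text \<open>For \<open>dx = - M x dt + \<sigma> dW\<close> with \<open>- M\<close> Hurwitz, the steady-state covariance of \<open>x\<close> is the
  unique solution of the Lyapunov equation below.\<close>

definition steady_state_covariance :: "real mat \<Rightarrow> real \<Rightarrow> real mat" where
  "steady_state_covariance M \<sigma> =
    (THE C. C \<in> carrier_mat (dim_row M) (dim_row M) \<and>
       M * C + C * transpose_mat M = \<sigma>\<^sup>2 \<cdot>\<^sub>m 1\<^sub>m (dim_row M))"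

definition total_system_error :: "real mat \<Rightarrow> real \<Rightarrow> nat set \<Rightarrow> real \<Rightarrow> real" where
  "total_system_error A \<sigma> S k =
    sum_list (diag_mat (steady_state_covariance (system_matrix A S k) \<sigma>))"

definition noise_free_error :: "real mat \<Rightarrow> real \<Rightarrow> nat set \<Rightarrow> real" where
  "noise_free_error A \<sigma> S = Lim at_top (total_system_error A \<sigma> S)"

definition optimal_noise_free_leaders :: "real mat \<Rightarrow> real \<Rightarrow> nat \<Rightarrow> nat set \<Rightarrow> bool" where
  "optimal_noise_free_leaders A \<sigma> m S \<longleftrightarrow>
    is_arg_min (noise_free_error A \<sigma>) (\<lambda>T. T \<subseteq> {1..dim_row A} \<and> card T = m) S"

text \<open>The library function \<open>round\<close> is \<open>x \<mapsto> \<lfloor>x + 1/2\<rfloor>\<close>, so half-integers are rounded up.\<close>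

definition rnd :: "real \<Rightarrow> nat" where
  "rnd x = nat (round x)"

end

theory Submission
  imports Defs
begin

text \<open>For a positive definite \<open>M\<close> the Lyapunov equation has a single solution,
  \<open>(\<sigma>\<^sup>2 / 2) M\<^sup>-\<^sup>1\<close> (\<open>steady_state_covariance_eq\<close>), so the error is a multiple of the
  trace of \<open>M\<^sup>-\<^sup>1\<close>. On a path with leaders \<open>a < b\<close> this inverse can be written down.
  Fixing both leaders at zero cuts the path into three independent pieces, and the Green's function
  of the Laplacian with these boundary values is piecewise linear in each argument. A finite gain
  \<open>k\<close> lets the two leaders move. Their motion splits into a common mode, which costs
  \<open>1 / (2 k)\<close> everywhere, and an opposite mode, which spreads along the path as the electric
  potential between the leaders; the latter sees the conductance \<open>1 / (b - a)\<close> between the leaders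
  on top of the gain. The sum of the three terms inverts \<open>M\<close> (\<open>gain_green_equation\<close>), and the
  contributions of the two modes vanish as \<open>k \<rightarrow> \<infinity>\<close>.

  The limit of the trace is the sum of the diagonal of the Green's function: distances to the
  leader on the two outer pieces, and the parabola \<open>(x - a) (b - x) / (b - a)\<close> in between.
  Hence the error is \<open>\<sigma>\<^sup>2 / 12\<close> times an integer quadratic polynomial in \<open>a\<close> and \<open>b\<close>
  (\<open>noise_free_error_path\<close>). The quadratic part is so strongly convex that an integer point is
  a minimum over the whole integer lattice as soon as both partial derivatives there are at most
  \<open>3\<close> in absolute value (\<open>path_cost_minimal_if_small_gradient\<close>). The rounded positions
  meet this bound in each residue class of \<open>n\<close> modulo \<open>5\<close>.\<close>

section \<open>The Lyapunov equation\<close>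

text \<open>The quadratic form is taken on functions rather than vectors, so that rows and columns of a
  matrix can be inserted without conversion.\<close>

definition positive_definite :: "real mat \<Rightarrow> bool" where
  "positive_definite M \<longleftrightarrow>
    (\<forall>v. (\<exists>i<dim_row M. v i \<noteq> 0) \<longrightarrow>
       (\<Sum>i<dim_row M. v i * (\<Sum>j<dim_row M. M $$ (i, j) * v j)) > 0)"

lemma positive_definite_nonneg:
  assumes "positive_definite M"
  shows "(\<Sum>i<dim_row M. v i * (\<Sum>j<dim_row M. M $$ (i, j) * v j)) \<ge> 0"
proof (cases "\<exists>i<dim_row M. v i \<noteq> 0")
  case True
  then show ?thesis using assms unfolding positive_definite_def by (meson less_imp_le)
next
  case False
  then show ?thesis by simp
qed

text \<open>Pairing the equation entrywise with \<open>X\<close> gives zero. The two halves of this pairing are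
  the quadratic form of \<open>M\<close> summed over the columns of \<open>X\<close> and over the rows of \<open>X\<close>, so all
  of these values are zero.\<close>

lemma homogeneous_lyapunov_trivial:
  fixes M X :: "real mat"
  assumes M: "M \<in> carrier_mat n n" and X: "X \<in> carrier_mat n n"
    and pd: "positive_definite M"
    and eq: "\<And>i j. i < n \<Longrightarrow> j < n \<Longrightarrow> (M * X) $$ (i, j) + (X * transpose_mat M) $$ (i, j) = 0"
    and i: "i < n" and j: "j < n"
  shows "X $$ (i, j) = 0"
proof (rule ccontr)
  assume nz: "X $$ (i, j) \<noteq> 0"
  define q where "q v = (\<Sum>i<n. v i * (\<Sum>l<n. M $$ (i, l) * v l))" for v
  have dim: "dim_row M = n" using M by simp
  have q_nonneg: "q v \<ge> 0" for v
    using positive_definite_nonneg[OF pd, of v] by (simp add: q_def dim)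
  have MX: "(M * X) $$ (r, c) = (\<Sum>l<n. M $$ (r, l) * X $$ (l, c))" if "r < n" "c < n" for r c
    using M X that by (simp add: scalar_prod_def atLeast0LessThan)
  have XM: "(X * transpose_mat M) $$ (r, c) = (\<Sum>l<n. M $$ (c, l) * X $$ (r, l))"
    if "r < n" "c < n" for r c
    using M X that by (simp add: scalar_prod_def atLeast0LessThan mult.commute)
  have "(\<Sum>c<n. q (\<lambda>r. X $$ (r, c))) + (\<Sum>r<n. q (\<lambda>c. X $$ (r, c)))
      = (\<Sum>r<n. \<Sum>c<n. X $$ (r, c) * ((M * X) $$ (r, c) + (X * transpose_mat M) $$ (r, c)))"
  proof -
    have "(\<Sum>c<n. q (\<lambda>r. X $$ (r, c))) = (\<Sum>c<n. \<Sum>r<n. X $$ (r, c) * (M * X) $$ (r, c))"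
      unfolding q_def by (intro sum.cong refl) (simp add: MX)
    also have "\<dots> = (\<Sum>r<n. \<Sum>c<n. X $$ (r, c) * (M * X) $$ (r, c))"
      by (rule sum.swap)
    finally have 1: "(\<Sum>c<n. q (\<lambda>r. X $$ (r, c))) = \<dots>" .
    have 2: "(\<Sum>r<n. q (\<lambda>c. X $$ (r, c)))
        = (\<Sum>r<n. \<Sum>c<n. X $$ (r, c) * (X * transpose_mat M) $$ (r, c))"
      unfolding q_def by (intro sum.cong refl) (simp add: XM)
    show ?thesis unfolding 1 2 by (simp add: sum.distrib distrib_left)
  qed
  also have "\<dots> = 0" using eq by simp
  finally have zero: "(\<Sum>c<n. q (\<lambda>r. X $$ (r, c))) + (\<Sum>r<n. q (\<lambda>c. X $$ (r, c))) = 0" .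
  have "q (\<lambda>r. X $$ (r, j)) > 0"
    using pd[unfolded positive_definite_def dim, rule_format, of "\<lambda>r. X $$ (r, j)"] i nz
    by (auto simp: q_def)
  then have "(\<Sum>c<n. q (\<lambda>r. X $$ (r, c))) > 0"
    using j q_nonneg by (intro sum_pos2[of _ j]) auto
  moreover have "(\<Sum>r<n. q (\<lambda>c. X $$ (r, c))) \<ge> 0"
    by (simp add: sum_nonneg q_nonneg)
  ultimately show False using zero by linarith
qed

text \<open>Since \<open>M\<close> and \<open>N\<close> are symmetric, transposing \<open>M N = 1\<close> gives \<open>N M = 1\<close>, and each of the two
  products in the equation contributes half of \<open>\<sigma>\<^sup>2\<close>.\<close>

lemma steady_state_covariance_eq:
  assumes M: "M \<in> carrier_mat n n" and N: "N \<in> carrier_mat n n"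
    and pd: "positive_definite M"
    and symM: "transpose_mat M = M" and symN: "transpose_mat N = N" and inv: "M * N = 1\<^sub>m n"
  shows "steady_state_covariance M \<sigma> = (\<sigma>\<^sup>2 / 2) \<cdot>\<^sub>m N"
  unfolding steady_state_covariance_def
proof (rule the_equality)
  have dim: "dim_row M = n" using M by simp
  have "N * M = transpose_mat (M * N)"
    using transpose_mult[OF M N] by (simp add: symM symN)
  then have inv': "N * M = 1\<^sub>m n" by (simp add: inv)
  have sol: "M * ((\<sigma>\<^sup>2 / 2) \<cdot>\<^sub>m N) + ((\<sigma>\<^sup>2 / 2) \<cdot>\<^sub>m N) * M = \<sigma>\<^sup>2 \<cdot>\<^sub>m 1\<^sub>m n"
    unfolding mult_smult_distrib[OF M N] mult_smult_assoc_mat[OF N M] inv inv'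
    by (rule eq_matI) simp_all
  then show "(\<sigma>\<^sup>2 / 2) \<cdot>\<^sub>m N \<in> carrier_mat (dim_row M) (dim_row M) \<and>
      M * ((\<sigma>\<^sup>2 / 2) \<cdot>\<^sub>m N) + (\<sigma>\<^sup>2 / 2) \<cdot>\<^sub>m N * transpose_mat M = \<sigma>\<^sup>2 \<cdot>\<^sub>m 1\<^sub>m (dim_row M)"
    using N by (simp add: dim symM)
  fix C
  assume "C \<in> carrier_mat (dim_row M) (dim_row M) \<and>
      M * C + C * transpose_mat M = \<sigma>\<^sup>2 \<cdot>\<^sub>m 1\<^sub>m (dim_row M)"
  then have C: "C \<in> carrier_mat n n" and solC: "M * C + C * M = \<sigma>\<^sup>2 \<cdot>\<^sub>m 1\<^sub>m n"
    by (auto simp: dim symM)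
  define D where "D = (\<sigma>\<^sup>2 / 2) \<cdot>\<^sub>m N"
  have D: "D \<in> carrier_mat n n" using N by (simp add: D_def)
  have "(C - D) $$ (i, j) = 0" if ij: "i < n" "j < n" for i j
  proof (rule homogeneous_lyapunov_trivial[OF M _ pd _ ij])
    show "C - D \<in> carrier_mat n n" using D by (rule minus_carrier_mat)
    fix r c assume rc: "r < n" "c < n"
    have "(M * C + C * M) $$ (r, c) = (M * D + D * M) $$ (r, c)"
      using sol solC by (simp add: D_def)
    then have "(M * C) $$ (r, c) + (C * M) $$ (r, c) = (M * D) $$ (r, c) + (D * M) $$ (r, c)"
      using M C D rc by simp
    then show "(M * (C - D)) $$ (r, c) + ((C - D) * transpose_mat M) $$ (r, c) = 0"
      using M C D rc
      by (simp add: symM mult_minus_distrib_mat[OF M C D] minus_mult_distrib_mat[OF C D M])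
  qed
  then have "C = D" using C D by (intro eq_matI) auto
  then show "C = (\<sigma>\<^sup>2 / 2) \<cdot>\<^sub>m N" by (simp add: D_def)
qed

section \<open>The matrix of the leader-follower system\<close>

lemma system_matrix_carrier:
  "A \<in> carrier_mat n n \<Longrightarrow> system_matrix A S k \<in> carrier_mat n n"
  by (auto simp: system_matrix_def laplacian_def degree_matrix_def leader_gain_def mat_diag_def)

lemma system_matrix_index:
  assumes "A \<in> carrier_mat n n" "i < n" "j < n"
  shows "system_matrix A S k $$ (i, j) =
    (if i = j then (\<Sum>l<n. A $$ (i, l)) + (if Suc i \<in> S then k else 0) else 0) - A $$ (i, j)"
  using assms
  by (auto simp: system_matrix_def laplacian_def degree_matrix_def leader_gain_def mat_diag_def)

lemma system_matrix_apply:
  assumes A: "A \<in> carrier_mat n n" and i: "i < n"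
  shows "(\<Sum>j<n. system_matrix A S k $$ (i, j) * f j) =
    (\<Sum>j<n. A $$ (i, j) * (f i - f j)) + (if Suc i \<in> S then k else 0) * f i"
proof -
  define g where "g = (if Suc i \<in> S then k else 0)"
  have "(\<Sum>j<n. system_matrix A S k $$ (i, j) * f j)
      = (\<Sum>j<n. (if i = j then ((\<Sum>l<n. A $$ (i, l)) + g) * f j else 0) - A $$ (i, j) * f j)"
    using i by (intro sum.cong refl) (simp add: system_matrix_index[OF A i] g_def algebra_simps)
  also have "\<dots> = ((\<Sum>l<n. A $$ (i, l)) + g) * f i - (\<Sum>j<n. A $$ (i, j) * f j)"
    using i by (simp add: sum_subtractf)
  also have "\<dots> = (\<Sum>j<n. A $$ (i, j) * (f i - f j)) + g * f i"
    by (simp add: algebra_simps sum_subtractf sum_distrib_left)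
  finally show ?thesis by (simp add: g_def)
qed

text \<open>Every edge is met from both of its ends; adding the two contributions
  \<open>v i * (v i - v j)\<close> and \<open>v j * (v j - v i)\<close> completes the square.\<close>

lemma system_matrix_quadratic_form:
  assumes A: "A \<in> carrier_mat n n" and sym: "\<And>i j. i < n \<Longrightarrow> j < n \<Longrightarrow> A $$ (i, j) = A $$ (j, i)"
  shows "(\<Sum>i<n. v i * (\<Sum>j<n. system_matrix A S k $$ (i, j) * v j)) =
    (\<Sum>i<n. \<Sum>j<n. A $$ (i, j) * (v i - v j)\<^sup>2) / 2
    + (\<Sum>i<n. (if Suc i \<in> S then k else 0) * (v i)\<^sup>2)"
proof -
  define E where "E = (\<Sum>i<n. \<Sum>j<n. A $$ (i, j) * (v i * (v i - v j)))"
  have "E = (\<Sum>j<n. \<Sum>i<n. A $$ (i, j) * (v i * (v i - v j)))"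
    unfolding E_def by (rule sum.swap)
  also have "\<dots> = (\<Sum>i<n. \<Sum>j<n. A $$ (i, j) * (v j * (v j - v i)))"
    by (intro sum.cong refl) (simp add: sym)
  finally have "2 * E = (\<Sum>i<n. \<Sum>j<n. A $$ (i, j) * (v i * (v i - v j)))
      + (\<Sum>i<n. \<Sum>j<n. A $$ (i, j) * (v j * (v j - v i)))"
    by (simp add: E_def)
  also have "\<dots> = (\<Sum>i<n. \<Sum>j<n. A $$ (i, j) * (v i - v j)\<^sup>2)"
    by (simp add: sum.distrib[symmetric] power2_eq_square algebra_simps)
  finally have E: "E = (\<Sum>i<n. \<Sum>j<n. A $$ (i, j) * (v i - v j)\<^sup>2) / 2" by simp
  have "(\<Sum>i<n. v i * (\<Sum>j<n. system_matrix A S k $$ (i, j) * v j))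
      = (\<Sum>i<n. (\<Sum>j<n. A $$ (i, j) * (v i * (v i - v j)))
          + (if Suc i \<in> S then k else 0) * (v i)\<^sup>2)"
    by (intro sum.cong refl, subst system_matrix_apply[OF A])
      (simp_all add: power2_eq_square distrib_left sum_distrib_left mult_ac)
  also have "\<dots> = E + (\<Sum>i<n. (if Suc i \<in> S then k else 0) * (v i)\<^sup>2)"
    by (simp add: E_def sum.distrib)
  finally show ?thesis by (simp add: E)
qed

section \<open>The path graph\<close>

lemma path_adjacency_carrier: "path_adjacency n \<in> carrier_mat n n"
  by (simp add: path_adjacency_def)

lemma path_adjacency_index:
  "i < n \<Longrightarrow> j < n \<Longrightarrow>
    path_adjacency n $$ (i, j) = (if j = Suc i \<or> i = Suc j then 1 else 0)"
  by (simp add: path_adjacency_def)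

lemma path_system_matrix_symmetric:
  "transpose_mat (system_matrix (path_adjacency n) S k) = system_matrix (path_adjacency n) S k"
  using system_matrix_carrier[OF path_adjacency_carrier, of n S k]
  by (intro eq_matI)
    (auto simp: system_matrix_index[OF path_adjacency_carrier] path_adjacency_index)

text \<open>If the energy vanishes, \<open>v\<close> is constant along the edges, hence on the whole path, and it is
  zero at a leader.\<close>

lemma path_system_matrix_positive_definite:
  assumes k: "k > 0" and s: "s \<in> S" "s \<in> {1..n}"
  shows "positive_definite (system_matrix (path_adjacency n) S k)"
proof -
  let ?A = "path_adjacency n"
  have dim: "dim_row (system_matrix ?A S k) = n"
    using system_matrix_carrier[OF path_adjacency_carrier, of n S k] by simp
  show ?thesis
    unfolding positive_definite_def dim
  proof (intro allI impI)
    fix v :: "nat \<Rightarrow> real"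
    assume nz: "\<exists>i<n. v i \<noteq> 0"
    define e where "e i j = ?A $$ (i, j) * (v i - v j)\<^sup>2" for i j
    define h where "h i = (if Suc i \<in> S then k else 0) * (v i)\<^sup>2" for i
    have form: "(\<Sum>i<n. v i * (\<Sum>j<n. system_matrix ?A S k $$ (i, j) * v j))
        = (\<Sum>i<n. \<Sum>j<n. e i j) / 2 + (\<Sum>i<n. h i)"
      unfolding e_def h_def
      by (rule system_matrix_quadratic_form[OF path_adjacency_carrier])
        (auto simp: path_adjacency_index)
    have e0: "e i j \<ge> 0" if "i < n" "j < n" for i j
      using that by (simp add: e_def path_adjacency_index)
    have h0: "h i \<ge> 0" for i using k by (simp add: h_def)
    have E0: "(\<Sum>i<n. \<Sum>j<n. e i j) \<ge> 0" by (intro sum_nonneg) (simp add: e0)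
    have H0: "(\<Sum>i<n. h i) \<ge> 0" by (intro sum_nonneg) (simp add: h0)
    show "(\<Sum>i<n. v i * (\<Sum>j<n. system_matrix ?A S k $$ (i, j) * v j)) > 0"
    proof (rule ccontr)
      assume "\<not> ?thesis"
      then have E: "(\<Sum>i<n. \<Sum>j<n. e i j) = 0" and H: "(\<Sum>i<n. h i) = 0"
        using form E0 H0 by linarith+
      have rows: "(\<Sum>j<n. e i j) = 0" if "i < n" for i
      proof -
        have "\<forall>i\<in>{..<n}. (\<Sum>j<n. e i j) = 0"
          using E by (subst (asm) sum_nonneg_eq_0_iff) (auto intro!: sum_nonneg simp: e0)
        with that show ?thesis by simp
      qed
      have e: "e i j = 0" if "i < n" "j < n" for i j
      proof -
        have "\<forall>j\<in>{..<n}. e i j = 0"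
          using rows[OF that(1)] that by (subst (asm) sum_nonneg_eq_0_iff) (auto simp: e0)
        with that show ?thesis by simp
      qed
      have step: "v (Suc i) = v i" if "Suc i < n" for i
        using e[of i "Suc i"] that by (simp add: e_def path_adjacency_index)
      have const: "v i = v 0" if "i < n" for i
        using that by (induction i) (simp_all add: step)
      have "\<forall>i\<in>{..<n}. h i = 0"
        using H by (subst (asm) sum_nonneg_eq_0_iff) (auto simp: h0)
      moreover have "s - 1 \<in> {..<n}" using s by auto
      ultimately have "h (s - 1) = 0" by blast
      then have "v (s - 1) = 0" using k s by (simp add: h_def)
      then have "v 0 = 0" using const[of "s - 1"] \<open>s - 1 \<in> {..<n}\<close> by simp
      then show False using const nz by auto
    qed
  qed
qed

text \<open>At an end of the path the Laplacian has only one neighbour. Extending \<open>g\<close> by one node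
  beyond each end with the same value (a reflecting boundary) turns it into a second difference at
  every node. Nodes are labelled from \<open>1\<close>, indices from \<open>0\<close>, hence the \<open>Suc\<close>.\<close>

lemma path_laplacian_apply:
  fixes g :: "int \<Rightarrow> real"
  assumes i: "i < n" and bdry: "g 0 = g 1" "g (int n + 1) = g (int n)"
  shows "(\<Sum>j<n. path_adjacency n $$ (i, j) * (g (int (Suc i)) - g (int (Suc j)))) =
    2 * g (int (Suc i)) - g (int (Suc i) - 1) - g (int (Suc i) + 1)"
proof -
  let ?x = "int (Suc i)"
  have "(\<Sum>j<n. path_adjacency n $$ (i, j) * (g ?x - g (int (Suc j))))
      = (\<Sum>j<n. (if j = Suc i then g ?x - g (?x + 1) else 0)
          + (if i = Suc j then g ?x - g (?x - 1) else 0))"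
    using i by (intro sum.cong refl) (auto simp: path_adjacency_index add_ac)
  also have "\<dots> = (if Suc i < n then g ?x - g (?x + 1) else 0)
      + (\<Sum>j<n. if i = Suc j then g ?x - g (?x - 1) else 0)"
    by (simp add: sum.distrib)
  also have "(if Suc i < n then g ?x - g (?x + 1) else 0) = g ?x - g (?x + 1)"
  proof (cases "Suc i < n")
    case False
    then have "n = Suc i" using i by simp
    then show ?thesis using bdry(2) by simp
  qed simp
  also have "(\<Sum>j<n. if i = Suc j then g ?x - g (?x - 1) else 0) = g ?x - g (?x - 1)"
  proof (cases i)
    case 0
    then show ?thesis using bdry(1) by simp
  next
    case (Suc l)
    then have "(\<Sum>j<n. if i = Suc j then g ?x - g (?x - 1) else 0)
        = (\<Sum>j<n. if j = l then g ?x - g (?x - 1) else 0)"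
      by (intro sum.cong refl) auto
    also have "\<dots> = g ?x - g (?x - 1)" using Suc i by simp
    finally show ?thesis .
  qed
  finally show ?thesis by simp
qed

section \<open>The inverse of the system matrix\<close>

definition clip :: "int \<Rightarrow> int \<Rightarrow> int \<Rightarrow> int" where
  "clip a b x = min b (max a x)"

text \<open>The response at \<open>x\<close> to a unit source at \<open>y\<close> when both leaders are held at zero. The three
  summands belong to the pieces left of \<open>a\<close>, between the leaders and right of \<open>b\<close>; the clipping
  and the maxima with \<open>0\<close> make a summand vanish unless both nodes lie in its piece, so that no
  case distinction on the positions is necessary.\<close>

definition grounded_green :: "int \<Rightarrow> int \<Rightarrow> int \<Rightarrow> int \<Rightarrow> real" where
  "grounded_green a b x y =
    of_int (max 0 (a - max x y))
    + of_int ((min (clip a b x) (clip a b y) - a) * (b - max (clip a b x) (clip a b y)))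
        / of_int (b - a)
    + of_int (max 0 (min x y - b))"

text \<open>The harmonic function that is \<open>1\<close> at the leader \<open>a\<close> and \<open>-1\<close> at the leader \<open>b\<close>.\<close>

definition leader_potential :: "int \<Rightarrow> int \<Rightarrow> int \<Rightarrow> real" where
  "leader_potential a b x = of_int (a + b - 2 * clip a b x) / of_int (b - a)"

text \<open>The entries of the inverse of the system matrix. Let \<open>p\<close> be the leader potential. A source
  at \<open>y\<close> drains into the grounded leaders in the shares \<open>(1 + p y) / 2\<close> and \<open>(1 - p y) / 2\<close>.
  The system matrix maps the constant \<open>1\<close> to \<open>k\<close> at both leaders, and \<open>p\<close> to
  \<open>k + 2 / (b - a)\<close> at \<open>a\<close> and its negative at \<open>b\<close>. The two added terms are the combination of
  \<open>1\<close> and \<open>p\<close> that is sent to exactly these shares.\<close>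

definition gain_green :: "int \<Rightarrow> int \<Rightarrow> real \<Rightarrow> int \<Rightarrow> int \<Rightarrow> real" where
  "gain_green a b k x y =
    grounded_green a b x y + 1 / (2 * k)
    + leader_potential a b x * leader_potential a b y / (2 * (k + 2 / of_int (b - a)))"

text \<open>As a function of \<open>x\<close>, \<open>H\<close> is a tent with apex \<open>y\<close> and feet \<open>a\<close> and \<open>b\<close>: its slopes are
  \<open>0\<close>, \<open>b - y\<close>, \<open>a - y\<close>, \<open>0\<close>, and the second difference records the three kinks. When \<open>y\<close> is
  one of the feet, \<open>H\<close> is zero and the terms cancel.\<close>

lemma second_difference_middle:
  fixes a b x y :: int
  assumes "a < b" "a \<le> y" "y \<le> b"
  defines "H \<equiv> \<lambda>x. (min (clip a b x) y - a) * (b - max (clip a b x) y)"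
  shows "2 * H x - H (x - 1) - H (x + 1) =
    (if x = y then b - a else 0) - (if x = a then b - y else 0) - (if x = b then y - a else 0)"
proof -
  have lo: "H z = 0" if "z \<le> a" for z
    using assms(1-3) that by (simp add: H_def clip_def)
  have lo': "H z = (z - a) * (b - y)" if "a \<le> z" "z \<le> y" for z
    using assms(1-3) that by (simp add: H_def clip_def)
  have hi': "H z = (y - a) * (b - z)" if "y \<le> z" "z \<le> b" for z
    using assms(1-3) that by (simp add: H_def clip_def)
  have hi: "H z = 0" if "b \<le> z" for z
    using assms(1-3) that by (simp add: H_def clip_def)
  consider "x < a" | "x = a" | "a < x" "x < y" | "a < x" "x = y" "x < b"
    | "a < x" "y < x" "x < b" | "x = b" | "b < x"
    using assms(1-3) by linarith
  then show ?thesis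
  proof cases
    case 1
    then show ?thesis
      using assms(1-3) lo
      by simp
  next
    case 2
    then show ?thesis
      using assms(1-3) lo lo'[of "x+1"] hi'[of "x+1"]
      by (cases "y = a") (simp_all add: algebra_simps)
  next
    case 3
    then show ?thesis
      using assms(1-3) lo'[of "x"] lo'[of "x+1"] lo'[of "x-1"]
      by (simp_all add: algebra_simps)
  next
    case 4
    then show ?thesis
      using assms(1-3) lo'[of "x"] hi'[of "x+1"] lo'[of "x-1"]
      by (simp_all add: algebra_simps)
  next
    case 5
    then show ?thesis
      using assms(1-3) hi'[of "x"] hi'[of "x+1"] hi'[of "x-1"]
      by (simp_all add: algebra_simps)
  next
    case 6
    then show ?thesis
      using assms(1-3) hi lo'[of "x-1"] hi'[of "x-1"]
      by (cases "y = b") (simp_all add: algebra_simps)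
  next
    case 7
    then show ?thesis
      using assms(1-3) hi
      by simp
  qed
qed

text \<open>Besides the unit source at \<open>y\<close> only the leaders carry a current: they absorb what reaches them,
  in the ratio given by the potential at \<open>y\<close>.\<close>

lemma grounded_green_second_difference:
  assumes ab: "a < b"
  shows "2 * grounded_green a b x y - grounded_green a b (x - 1) y - grounded_green a b (x + 1) y =
    of_bool (x = y) - (1 + leader_potential a b y) / 2 * of_bool (x = a)
    - (1 - leader_potential a b y) / 2 * of_bool (x = b)"
proof -
  define c where "c = clip a b y"
  have c: "a \<le> c" "c \<le> b" using ab by (auto simp: c_def clip_def)
  define H where "H x = (min (clip a b x) c - a) * (b - max (clip a b x) c)" for x
  define l where "l x = max 0 (a - max x y)" for x
  define r where "r x = max 0 (min x y - b)" for x
  have L: "2 * l x - l (x - 1) - l (x + 1) = of_bool (x = min y a) - of_bool (x = a)"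
    unfolding l_def
    by (cases "y < a"; cases "x < y"; cases "x = y"; cases "x < a"; cases "x = a"; simp)
  have R: "2 * r x - r (x - 1) - r (x + 1) = of_bool (x = max y b) - of_bool (x = b)"
    unfolding r_def
    by (cases "b < y"; cases "x < y"; cases "x = y"; cases "x < b"; cases "x = b"; simp)
  have "2 * H x - H (x - 1) - H (x + 1) =
      (b - a) * of_bool (x = c) - (b - c) * of_bool (x = a) - (c - a) * of_bool (x = b)"
    using second_difference_middle[OF ab c, of x] by (simp add: H_def)
  then have M: "real_of_int (2 * H x - H (x - 1) - H (x + 1)) =
      of_int (b - a) * of_bool (x = c) - of_int (b - c) * of_bool (x = a)
      - of_int (c - a) * of_bool (x = b)"
    by (simp only: of_int_diff of_int_mult of_int_of_bool)
  have d: "real_of_int (b - a) \<noteq> 0" using ab by simp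
  have split: "(D * P - A * Q - B * R) / D = P - A / D * Q - B / D * R"
    if "D \<noteq> 0" for A B D P Q R :: real
    using that by (simp add: diff_divide_distrib)
  have G: "grounded_green a b x y = of_int (l x) + of_int (H x) / of_int (b - a) + of_int (r x)" for x
    by (simp add: grounded_green_def l_def r_def H_def c_def)
  have "2 * grounded_green a b x y - grounded_green a b (x - 1) y - grounded_green a b (x + 1) y
      = of_int (2 * l x - l (x - 1) - l (x + 1))
        + of_int (2 * H x - H (x - 1) - H (x + 1)) / of_int (b - a)
        + of_int (2 * r x - r (x - 1) - r (x + 1))"
    unfolding G by (simp add: diff_divide_distrib)
  also have "\<dots> = (of_bool (x = min y a) + of_bool (x = c) + of_bool (x = max y b))
      - of_bool (x = a) - of_bool (x = b)
      - of_int (b - c) / of_int (b - a) * of_bool (x = a)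
      - of_int (c - a) / of_int (b - a) * of_bool (x = b)"
    unfolding L M R split[OF d] by simp
  \<comment> \<open>The numbers \<open>min y a\<close>, \<open>c\<close> and \<open>max y b\<close> are \<open>y\<close>, \<open>a\<close> and \<open>b\<close> in some order.\<close>
  also have "of_bool (x = min y a) + of_bool (x = c) + of_bool (x = max y b)
      = (of_bool (x = y) + of_bool (x = a) + of_bool (x = b) :: real)"
    using ab by (auto simp: c_def clip_def min_def max_def)
  also have "of_int (b - c) / of_int (b - a) = (1 + leader_potential a b y) / 2"
    using d by (simp add: leader_potential_def c_def field_simps)
  also have "of_int (c - a) / of_int (b - a) = (1 - leader_potential a b y) / 2"
    using d by (simp add: leader_potential_def c_def field_simps)
  finally show ?thesis by simp
qed

lemma leader_potential_second_difference:
  assumes ab: "a < b"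
  shows "2 * leader_potential a b x - leader_potential a b (x - 1) - leader_potential a b (x + 1) =
    2 / of_int (b - a) * (of_bool (x = a) - of_bool (x = b))"
proof -
  have "2 * clip a b x - clip a b (x - 1) - clip a b (x + 1) = of_bool (x = b) - of_bool (x = a)"
    using ab by (cases "x < a"; cases "x = a"; cases "x < b"; cases "x = b"; simp add: clip_def)
  then have c: "real_of_int (2 * clip a b x - clip a b (x - 1) - clip a b (x + 1))
      = of_bool (x = b) - of_bool (x = a)"
    by simp
  have "2 * leader_potential a b x - leader_potential a b (x - 1) - leader_potential a b (x + 1)
      = - 2 * of_int (2 * clip a b x - clip a b (x - 1) - clip a b (x + 1)) / of_int (b - a)"
    by (simp add: leader_potential_def diff_divide_distrib[symmetric] add_divide_distrib[symmetric])
  then show ?thesis unfolding c by (simp add: field_simps)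
qed

lemma gain_green_equation:
  assumes ab: "a < b" and k: "k > 0"
  shows "2 * gain_green a b k x y - gain_green a b k (x - 1) y - gain_green a b k (x + 1) y
    + (if x = a \<or> x = b then k else 0) * gain_green a b k x y = of_bool (x = y)"
proof -
  define p where "p = leader_potential a b"
  define \<kappa> where "\<kappa> = k + 2 / of_int (b - a)"
  have d: "real_of_int (b - a) > 0" using ab by simp
  then have \<kappa>: "\<kappa> > 0" using k by (simp add: \<kappa>_def add_pos_nonneg)
  have green: "gain_green a b k x y = grounded_green a b x y + 1 / (2 * k) + p x * p y / (2 * \<kappa>)" for x
    by (simp only: gain_green_def p_def \<kappa>_def)
  have diff: "2 * gain_green a b k x y - gain_green a b k (x - 1) y - gain_green a b k (x + 1) y
      = (2 * grounded_green a b x y - grounded_green a b (x - 1) y - grounded_green a b (x + 1) y)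
        + (2 * p x - p (x - 1) - p (x + 1)) * p y / (2 * \<kappa>)"
    unfolding green
    by (simp add: algebra_simps diff_divide_distrib add_divide_distrib)
  have pa: "p a = 1" and pb: "p b = -1"
    using ab by (simp_all add: p_def leader_potential_def clip_def field_simps)
  have Ga: "grounded_green a b a y = 0" and Gb: "grounded_green a b b y = 0"
    using ab by (simp_all add: grounded_green_def clip_def)
  have gain: "(if x = a \<or> x = b then k else 0) * gain_green a b k x y
      = (1 / 2 + k * p y / (2 * \<kappa>)) * of_bool (x = a) + (1 / 2 - k * p y / (2 * \<kappa>)) * of_bool (x = b)"
    using ab k
    by (auto simp: green Ga Gb pa pb distrib_left)
  \<comment> \<open>Expressing twice the conductance by \<open>\<kappa>\<close> lets the terms in \<open>k / \<kappa>\<close> cancel.\<close>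
  have two: "2 / of_int (b - a) = \<kappa> - k" by (simp add: \<kappa>_def)
  \<comment> \<open>The indicators are generalized to real numbers: the cancellation is an identity in them.\<close>
  have collect: "E - (1 + q) / 2 * A - (1 - q) / 2 * B + (\<kappa> - k) * (A - B) * q / (2 * \<kappa>)
      + ((1 / 2 + k * q / (2 * \<kappa>)) * A + (1 / 2 - k * q / (2 * \<kappa>)) * B) = E" for A B E q :: real
    using \<kappa> by (simp add: field_simps)
  show ?thesis
    unfolding diff gain grounded_green_second_difference[OF ab]
      leader_potential_second_difference[OF ab, folded p_def] two
    unfolding p_def[symmetric] by (rule collect)
qed

lemma gain_green_commute: "gain_green a b k x y = gain_green a b k y x"
  by (simp add: gain_green_def grounded_green_def max.commute min.commute)

definition path_inverse :: "nat \<Rightarrow> nat \<Rightarrow> nat \<Rightarrow> real \<Rightarrow> real mat" where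
  "path_inverse n a b k =
    mat n n (\<lambda>(i, j). gain_green (int a) (int b) k (int (Suc i)) (int (Suc j)))"

lemma path_inverse_right:
  assumes ab: "1 \<le> a" "a < b" "b \<le> n" and k: "k > 0"
  shows "system_matrix (path_adjacency n) {a, b} k * path_inverse n a b k = 1\<^sub>m n"
proof (rule eq_matI)
  let ?M = "system_matrix (path_adjacency n) {a, b} k"
  have M: "?M \<in> carrier_mat n n" by (rule system_matrix_carrier[OF path_adjacency_carrier])
  fix i j assume "i < dim_row (1\<^sub>m n)" "j < dim_col (1\<^sub>m n)"
  then have ij: "i < n" "j < n" by simp_all
  define g where "g x = gain_green (int a) (int b) k x (int (Suc j))" for x
  have g: "g 0 = g 1" "g (int n + 1) = g (int n)"
    using ab ij
    by (simp_all add: g_def gain_green_def grounded_green_def leader_potential_def clip_def)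
  have "(?M * path_inverse n a b k) $$ (i, j) = (\<Sum>l<n. ?M $$ (i, l) * g (int (Suc l)))"
    using M ij by (simp add: scalar_prod_def atLeast0LessThan path_inverse_def g_def)
  also have "\<dots> = 2 * g (int (Suc i)) - g (int (Suc i) - 1) - g (int (Suc i) + 1)
      + (if Suc i \<in> {a, b} then k else 0) * g (int (Suc i))"
    using system_matrix_apply[OF path_adjacency_carrier ij(1), of "{a, b}" k "\<lambda>l. g (int (Suc l))"]
      path_laplacian_apply[OF ij(1) g] by simp
  also have "(if Suc i \<in> {a, b} then k else 0)
      = (if int (Suc i) = int a \<or> int (Suc i) = int b then k else 0)"
    by (simp only: of_nat_eq_iff insert_iff empty_iff simp_thms)
  also have "2 * g (int (Suc i)) - g (int (Suc i) - 1) - g (int (Suc i) + 1) + \<dots> * g (int (Suc i))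
      = of_bool (int (Suc i) = int (Suc j))"
    unfolding g_def using ab k by (intro gain_green_equation) simp_all
  also have "\<dots> = 1\<^sub>m n $$ (i, j)" using ij by simp
  finally show "(?M * path_inverse n a b k) $$ (i, j) = 1\<^sub>m n $$ (i, j)" .
qed (use system_matrix_carrier[OF path_adjacency_carrier, of n "{a, b}" k] in
    \<open>simp_all add: path_inverse_def\<close>)

section \<open>The error of two noise-free leaders\<close>

lemma total_system_error_path:
  assumes ab: "1 \<le> a" "a < b" "b \<le> n" and k: "k > 0"
  shows "total_system_error (path_adjacency n) \<sigma> {a, b} k =
    \<sigma>\<^sup>2 / 2 * (\<Sum>i<n. gain_green (int a) (int b) k (int (Suc i)) (int (Suc i)))"
proof -
  have N: "path_inverse n a b k \<in> carrier_mat n n" by (simp add: path_inverse_def)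
  have symN: "transpose_mat (path_inverse n a b k) = path_inverse n a b k"
    by (rule eq_matI) (simp_all add: path_inverse_def gain_green_commute)
  have "steady_state_covariance (system_matrix (path_adjacency n) {a, b} k) \<sigma>
      = (\<sigma>\<^sup>2 / 2) \<cdot>\<^sub>m path_inverse n a b k"
    using ab
    by (intro steady_state_covariance_eq[OF system_matrix_carrier[OF path_adjacency_carrier] N]
        path_system_matrix_positive_definite[OF k, of a] path_system_matrix_symmetric symN
        path_inverse_right k) auto
  moreover have "sum_list (diag_mat ((\<sigma>\<^sup>2 / 2) \<cdot>\<^sub>m path_inverse n a b k))
      = (\<Sum>i<n. \<sigma>\<^sup>2 / 2 * gain_green (int a) (int b) k (int (Suc i)) (int (Suc i)))"
    by (simp add: diag_mat_def path_inverse_def interv_sum_list_conv_sum_set_nat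
        atLeast0LessThan del: of_nat_Suc)
  ultimately show ?thesis by (simp add: total_system_error_def sum_distrib_left)
qed

text \<open>The two terms that a finite gain adds to the Green's function tend to zero.\<close>

lemma noise_free_error_path_green:
  assumes ab: "1 \<le> a" "a < b" "b \<le> n"
  shows "noise_free_error (path_adjacency n) \<sigma> {a, b} =
    \<sigma>\<^sup>2 / 2 * (\<Sum>i<n. grounded_green (int a) (int b) (int (Suc i)) (int (Suc i)))"
  unfolding noise_free_error_def
proof (rule tendsto_Lim)
  have shift: "filterlim (\<lambda>k::real. k + c) at_top at_top" for c
    using filterlim_tendsto_add_at_top[OF tendsto_const[of c] filterlim_ident]
    by (simp add: add.commute)
  have green: "((\<lambda>k. gain_green (int a) (int b) k x y)
      \<longlongrightarrow> grounded_green (int a) (int b) x y) at_top" for x y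
  proof -
    have 1: "((\<lambda>k. 1 / (2 * k)) \<longlongrightarrow> 0) (at_top :: real filter)"
      by (intro tendsto_divide_0[OF tendsto_const] filterlim_at_top_imp_at_infinity
          filterlim_tendsto_pos_mult_at_top[OF tendsto_const _ filterlim_ident]) simp
    have 2: "((\<lambda>k. c / (2 * (k + e))) \<longlongrightarrow> 0) (at_top :: real filter)" for c e
      by (intro tendsto_divide_0[OF tendsto_const] filterlim_at_top_imp_at_infinity
          filterlim_tendsto_pos_mult_at_top[OF tendsto_const _ shift]) simp
    show ?thesis
      unfolding gain_green_def
      by (rule tendsto_eq_rhs[OF tendsto_add[OF tendsto_add[OF tendsto_const 1] 2]]) simp
  qed
  have "((\<lambda>k. \<sigma>\<^sup>2 / 2 * (\<Sum>i<n. gain_green (int a) (int b) k (int (Suc i)) (int (Suc i))))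
      \<longlongrightarrow> \<sigma>\<^sup>2 / 2 * (\<Sum>i<n. grounded_green (int a) (int b) (int (Suc i)) (int (Suc i)))) at_top"
    by (intro tendsto_mult tendsto_const tendsto_sum green)
  moreover have "eventually (\<lambda>k. \<sigma>\<^sup>2 / 2 * (\<Sum>i<n. gain_green (int a) (int b) k (int (Suc i)) (int (Suc i)))
      = total_system_error (path_adjacency n) \<sigma> {a, b} k) at_top"
    using eventually_gt_at_top[of 0]
    by eventually_elim (simp only: total_system_error_path[OF ab])
  ultimately show "(total_system_error (path_adjacency n) \<sigma> {a, b}
      \<longlongrightarrow> \<sigma>\<^sup>2 / 2 * (\<Sum>i<n. grounded_green (int a) (int b) (int (Suc i)) (int (Suc i)))) at_top"
    by (rule Lim_transform_eventually)
qed simp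

text \<open>The partial sums follow three different polynomials, one on each piece; the value at the end of
  a piece starts the induction on the next.\<close>

lemma sum_grounded_green_diagonal:
  assumes ab: "a < b" "b \<le> n"
  shows "(\<Sum>i<n. grounded_green (int a) (int b) (int (Suc i)) (int (Suc i))) =
    real a * (real a - 1) / 2 + ((real b - real a)\<^sup>2 - 1) / 6
    + (real n - real b) * (real n - real b + 1) / 2"
proof -
  define G where "G i = grounded_green (int a) (int b) (int (Suc i)) (int (Suc i))" for i
  define d where "d = real b - real a"
  have d: "d > 0" using ab by (simp add: d_def)
  have left: "(\<Sum>i<m. G i) = real a * real m - real m * (real m + 1) / 2" if "m \<le> a" for m
    using that
  proof (induction m)
    case (Suc m)
    have "G m = real a - (real m + 1)"
      using Suc.prems ab by (simp add: G_def grounded_green_def clip_def)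
    then show ?case using Suc by (simp add: field_simps)
  qed simp
  have middle: "(\<Sum>i<m. G i) = real a * (real a - 1) / 2
      + ((real m - a) * (real m - a + 1) / 2
         - (real m - a) * (real m - a + 1) * (2 * (real m - a) + 1) / (6 * d))"
    if "a \<le> m" "m \<le> b" for m
    using that
  proof (induction m rule: dec_induct)
    case base
    then show ?case using left[of a] by (simp add: field_simps)
  next
    case (step m)
    have "G m = (real m + 1 - a) * (b - (real m + 1)) / d"
      using step.hyps step.prems by (simp add: G_def grounded_green_def clip_def d_def add_ac)
    also have "real b = d + a" by (simp add: d_def)
    finally show ?case using step d by (simp add: field_simps)
  qed
  have right: "(\<Sum>i<m. G i) = real a * (real a - 1) / 2 + (d\<^sup>2 - 1) / 6
      + (real m - b) * (real m - b + 1) / 2"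
    if "b \<le> m" for m
    using that
  proof (induction m rule: dec_induct)
    case base
    have "(real b - a) * (real b - a + 1) / 2
         - (real b - a) * (real b - a + 1) * (2 * (real b - a) + 1) / (6 * d) = (d\<^sup>2 - 1) / 6"
      using d unfolding d_def[symmetric] by (simp add: field_simps power2_eq_square)
    then show ?case using middle[of b] ab by simp
  next
    case (step m)
    have "G m = real m + 1 - b"
      using step.hyps ab by (simp add: G_def grounded_green_def clip_def)
    then show ?case using step by (simp add: field_simps)
  qed
  show ?thesis using right[OF ab(2)] by (simp add: G_def d_def)
qed

text \<open>Six times the diagonal sum; the factor makes it integral, so that the minimization takes place
  over the integers.\<close>

definition path_cost :: "int \<Rightarrow> int \<Rightarrow> int \<Rightarrow> int" where
  "path_cost n a b = 3 * a * (a - 1) + (b - a)\<^sup>2 - 1 + 3 * (n - b) * (n - b + 1)"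

lemma noise_free_error_path:
  assumes "1 \<le> a" "a < b" "b \<le> n"
  shows "noise_free_error (path_adjacency n) \<sigma> {a, b} =
    \<sigma>\<^sup>2 / 12 * of_int (path_cost (int n) (int a) (int b))"
  unfolding noise_free_error_path_green[OF assms] sum_grounded_green_diagonal[OF assms(2,3)]
  by (simp add: path_cost_def field_simps)

section \<open>The optimal pair of leaders\<close>

lemma abs_le_square_int: "\<bar>s\<bar> \<le> s\<^sup>2" for s :: int
proof (cases "s = 0")
  case False
  then show ?thesis using self_le_power[of "\<bar>s\<bar>" 2] by simp
qed simp

text \<open>Moving the leaders inwards by \<open>s\<close> and \<open>t\<close> changes the cost by
  \<open>3 s\<^sup>2 + 3 t\<^sup>2 + (s + t)\<^sup>2 + u s + v t\<close>, where \<open>u\<close> and \<open>v\<close> are the quantities bounded in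
  the hypotheses. For integers \<open>\<bar>s\<bar> \<le> s\<^sup>2\<close>, so the linear terms are dominated. With the
  bound \<open>3\<close> the minimum need not be unique: when \<open>5\<close> divides \<open>n\<close>, the mirror image of the
  optimal pair is another one.\<close>

lemma path_cost_minimal_if_small_gradient:
  assumes g: "\<bar>6 * a - 3 - 2 * (b - a)\<bar> \<le> 3" and h: "\<bar>6 * (n - b) + 3 - 2 * (b - a)\<bar> \<le> 3"
  shows "path_cost n a b \<le> path_cost n a' b'"
proof -
  define s t where "s = a' - a" and "t = b - b'"
  define u v where "u = 6 * a - 3 - 2 * (b - a)" and "v = 6 * (n - b) + 3 - 2 * (b - a)"
  have "path_cost n a' b' - path_cost n a b = 3 * s\<^sup>2 + 3 * t\<^sup>2 + (s + t)\<^sup>2 + u * s + v * t"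
    by (simp add: path_cost_def s_def t_def u_def v_def power2_eq_square algebra_simps)
  moreover have "\<bar>u * s\<bar> \<le> 3 * s\<^sup>2"
    using mult_mono[OF g abs_le_square_int[of s]] by (simp add: u_def abs_mult)
  moreover have "\<bar>v * t\<bar> \<le> 3 * t\<^sup>2"
    using mult_mono[OF h abs_le_square_int[of t]] by (simp add: v_def abs_mult)
  moreover have "(s + t)\<^sup>2 \<ge> 0" by simp
  ultimately show ?thesis by linarith
qed

text \<open>The offset \<open>1 / 2\<close> and the rounding offset add up to \<open>1\<close>, so the rounded positions are plain
  integer divisions.\<close>

lemma optimal_positions:
  "rnd (real n / 5 + 1 / 2) = n div 5 + 1" "rnd (4 * real n / 5 + 1 / 2) = 4 * n div 5 + 1"
proof -
  have fl: "\<lfloor>real m / 5\<rfloor> = int (m div 5)" for m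
    using floor_divide_of_nat_eq[of m 5, where 'a = real] by simp
  have *: "rnd (real m / 5 + 1 / 2) = m div 5 + 1" for m
  proof -
    have "round (real m / 5 + 1 / 2) = \<lfloor>real m / 5\<rfloor> + 1"
      by (simp add: round_def add.assoc)
    then show ?thesis by (simp add: rnd_def fl)
  qed
  show "rnd (real n / 5 + 1 / 2) = n div 5 + 1" by (rule *)
  show "rnd (4 * real n / 5 + 1 / 2) = 4 * n div 5 + 1" using *[of "4 * n"] by simp
qed

theorem corollary3:
  fixes n :: nat and \<sigma> :: real
  assumes "n \<ge> 3" and "\<sigma> > 0"
  shows "optimal_noise_free_leaders (path_adjacency n) \<sigma> 2
           {rnd (real n / 5 + 1 / 2), rnd (4 * real n / 5 + 1 / 2)}"
proof -
  define a b where "a = n div 5 + 1" and "b = 4 * n div 5 + 1"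
  define m r where "m = n div 5" and "r = n mod 5"
  have n: "n = 5 * m + r" and "r < 5" by (simp_all add: m_def r_def)
  have a: "a = m + 1" by (simp add: a_def m_def)
  have "4 * n = 5 * (4 * m) + 4 * r" by (simp add: n)
  then have b: "b = 4 * m + 4 * r div 5 + 1" by (simp add: b_def)
  \<comment> \<open>For \<open>r = 0\<close> the quantities bounded in \<open>ga\<close> and \<open>gb\<close> are \<open>3\<close> and \<open>-3\<close>; otherwise both
    are \<open>5 - 2 r\<close>.\<close>
  have "r = 0 \<or> r = 1 \<or> r = 2 \<or> r = 3 \<or> r = 4" using \<open>r < 5\<close> by linarith
  then have ab: "1 \<le> a" "a < b" "b \<le> n"
    and ga: "\<bar>6 * int a - 3 - 2 * (int b - int a)\<bar> \<le> 3"
    and gb: "\<bar>6 * (int n - int b) + 3 - 2 * (int b - int a)\<bar> \<le> 3"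
    using assms(1) unfolding a b n by auto
  have dim: "dim_row (path_adjacency n) = n" by (simp add: path_adjacency_def)
  have "noise_free_error (path_adjacency n) \<sigma> {a, b} \<le> noise_free_error (path_adjacency n) \<sigma> T"
    if T: "T \<subseteq> {1..n}" "card T = 2" for T
  proof -
    obtain x y where "T = {x, y}" "x \<noteq> y" using T(2) by (meson card_2_iff)
    then obtain p q where pq: "T = {p, q}" "p < q" by (metis insert_commute linorder_neqE_nat)
    then have "1 \<le> p" "q \<le> n" using T(1) by auto
    then have "noise_free_error (path_adjacency n) \<sigma> T
        = \<sigma>\<^sup>2 / 12 * of_int (path_cost (int n) (int p) (int q))"
      using noise_free_error_path[of p q n \<sigma>] pq by simp
    moreover have "path_cost (int n) (int a) (int b) \<le> path_cost (int n) (int p) (int q)"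
      by (rule path_cost_minimal_if_small_gradient[OF ga gb])
    ultimately show ?thesis
      unfolding noise_free_error_path[OF ab] by (simp add: mult_left_mono)
  qed
  moreover have "{a, b} \<subseteq> {1..n}" "card {a, b} = 2" using ab by auto
  ultimately show ?thesis
    unfolding optimal_noise_free_leaders_def optimal_positions is_arg_min_linorder dim
    by (simp add: a_def b_def)
qed

end
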